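(* Let $\alpha,\ell>0$. Let $(Y_m)_{m=1}^\infty$ be a sequence of sets such that each $Y_m\subset(0,1)$ consists of $m$ distinct points and, for some constant $c_{\mathrm{qu}}>0$, $h_{Y_m,(0,1)}\le c_{\mathrm{qu}}m^{-1}$ for every $m\ge1$. For $p,q\in\mathbb{N}$ let $Y_p^{q,+}=\{x+q-1 : x\in Y_p\}$, $Y_p^{q,-}=\{x-q : x\in Y_p\}$ and $$X_k=\bigcup_{m=1}^k\left(Y_{k-m+1}^{m,+}\cup Y_{k-m+1}^{m,-}\right),\qquad n=\#X_k .$$ Let $\bar{h}_0=\min\{h_0(\ell),c_{\mathrm{qu}}^{-1}\}$, where $h_0(\ell)\in(0,1]$ is the constant fixed in the context. Then there is a positive constant $C$, which depends only on $\ell$, $\alpha$ and $c_{\mathrm{qu}}$, such that $$e_{\alpha,\ell}(Q^{\mathrm{opt}}_{\alpha,\ell,X_k})\le C\exp\left(-\frac{\sqrt{n}}{2\sqrt{2}\,\alpha^2}\right)$$ whenever $k\ge2c_{\mathrm{qu}}\bar{h}_0^{-1}$.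
   Context: $I_\alpha(f)=\frac{1}{\sqrt{2\pi}\,\alpha}\int_{\mathbb{R}}f(x)\exp(-x^2/(2\alpha^2))\,dx$; $K_\ell(x,y)=\exp(-(x-y)^2/(2\ell^2))$ on $\mathbb{R}\times\mathbb{R}$, with reproducing kernel Hilbert space $\mathcal{H}(K_\ell)$ and norm $\|\cdot\|_\ell$. The worst-case error of a quadrature rule $Q$ is $e_{\alpha,\ell}(Q)=\sup_{\|f\|_\ell\le1}|I_\alpha(f)-Q(f)|$. For a finite set $X=\{x_1,\dots,x_n\}\subset\mathbb{R}$ of distinct points, $Q^{\mathrm{opt}}_{\alpha,\ell,X}(f)=\sum_{i=1}^n w_i f(x_i)$ is the rule on the points $X$ whose weights $(w_1,\dots,w_n)\in\mathbb{R}^n$ minimise the worst-case error $e_{\alpha,\ell}$ among all weights in $\mathbb{R}^n$. The power function is $P_{\ell,X}(x)=\sup_{\|f\|_\ell\le1}|f(x)-(s_{\ell,X}f)(x)|=\sup\{f(x) : \|f\|_\ell\le1,\ f(x_i)=0\text{ for all }x_i\in X\}$, where $s_{\ell,X}f$ is the element of minimal norm in $\mathcal{H}(K_\ell)$ that interpolates $f$ at the points of $X$. The fill-distance of a finite set $X$ on a bounded set $\Omega\subset\mathbb{R}$ is $h_{X,\Omega}=\sup_{x\in\Omega}\min_{x_i\in X\cap\Omega}|x-x_i|$, understood as $+\infty$ if $X\cap\Omega=\emptyset$ ($X$ need not be a subset of $\Omega$). For each $\ell>0$, fix constants $A(\ell)>0$ and $h_0(\ell)\in(0,1]$, depending only on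 $\ell$, such that for every closed interval $\Omega\subset\mathbb{R}$ of length $1$ and every finite set $X\subset\mathbb{R}$ of distinct points, $\int_\Omega P_{\ell,X}(x)\,dx\le\exp\left(A(\ell)\log(h_{X,\Omega})\,h_{X,\Omega}^{-1}\right)$ whenever $h_{X,\Omega}\le h_0(\ell)$; such constants exist. *)

theory Defs
  imports "HOL-Analysis.Analysis"
begin

definition gauss_kernel :: "real \<Rightarrow> real \<Rightarrow> real \<Rightarrow> real" where
  "gauss_kernel l x y = exp (- ((x - y)\<^sup>2) / (2 * l\<^sup>2))"

definition gauss_integral :: "real \<Rightarrow> (real \<Rightarrow> real) \<Rightarrow> real" where
  "gauss_integral \<alpha> f =
     1 / (sqrt (2 * pi) * \<alpha>) * (LINT x|lborel. f x * exp (- (x\<^sup>2) / (2 * \<alpha>\<^sup>2)))"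

definition fun_norm :: "(('a \<Rightarrow> real) \<Rightarrow> ('a \<Rightarrow> real) \<Rightarrow> real) \<Rightarrow> ('a \<Rightarrow> real) \<Rightarrow> real" where
  "fun_norm ip f = sqrt (ip f f)"

text \<open>A Hilbert space of functions is given by a carrier \<open>H\<close> and an inner product \<open>ip\<close>, of which
  only the values on \<open>H \<times> H\<close> are relevant. These axioms determine \<open>H\<close>, and \<open>ip\<close> on \<open>H\<close>,
  uniquely from \<open>K\<close>.\<close>

locale rkhs =
  fixes K :: "'a \<Rightarrow> 'a \<Rightarrow> real"
    and H :: "('a \<Rightarrow> real) set"
    and ip :: "('a \<Rightarrow> real) \<Rightarrow> ('a \<Rightarrow> real) \<Rightarrow> real"
  assumes zero_mem: "(\<lambda>x. 0) \<in> H"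
    and add_mem: "f \<in> H \<Longrightarrow> g \<in> H \<Longrightarrow> (\<lambda>x. f x + g x) \<in> H"
    and scale_mem: "f \<in> H \<Longrightarrow> (\<lambda>x. c * f x) \<in> H"
    and ip_commute: "f \<in> H \<Longrightarrow> g \<in> H \<Longrightarrow> ip f g = ip g f"
    and ip_add: "f \<in> H \<Longrightarrow> g \<in> H \<Longrightarrow> h \<in> H \<Longrightarrow> ip (\<lambda>x. f x + g x) h = ip f h + ip g h"
    and ip_scale: "f \<in> H \<Longrightarrow> g \<in> H \<Longrightarrow> ip (\<lambda>x. c * f x) g = c * ip f g"
    and ip_nonneg: "f \<in> H \<Longrightarrow> ip f f \<ge> 0"
    and ip_definite: "f \<in> H \<Longrightarrow> ip f f = 0 \<Longrightarrow> f = (\<lambda>x. 0)"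
    and complete: "(\<And>n. s n \<in> H) \<Longrightarrow>
       (\<And>e. e > 0 \<Longrightarrow> \<exists>N. \<forall>m\<ge>N. \<forall>n\<ge>N. fun_norm ip (\<lambda>x. s m x - s n x) < e) \<Longrightarrow>
       \<exists>f\<in>H. (\<lambda>n :: nat. fun_norm ip (\<lambda>x. s n x - f x)) \<longlonglongrightarrow> 0"
    and kernel_mem: "(\<lambda>x. K x y) \<in> H"
    and reproducing: "f \<in> H \<Longrightarrow> f y = ip f (\<lambda>x. K x y)"

text \<open>Suprema are taken in \<^typ>\<open>ennreal\<close>, so that they need no boundedness side condition.\<close>

definition worst_case_error ::
    "(real \<Rightarrow> real) set \<Rightarrow> ((real \<Rightarrow> real) \<Rightarrow> (real \<Rightarrow> real) \<Rightarrow> real) \<Rightarrow> real \<Rightarrow>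
     ((real \<Rightarrow> real) \<Rightarrow> real) \<Rightarrow> ennreal" where
  "worst_case_error H ip \<alpha> Q =
     (SUP f\<in>{f \<in> H. fun_norm ip f \<le> 1}. ennreal \<bar>gauss_integral \<alpha> f - Q f\<bar>)"

definition quadrature :: "real set \<Rightarrow> (real \<Rightarrow> real) \<Rightarrow> (real \<Rightarrow> real) \<Rightarrow> real" where
  "quadrature X w f = (\<Sum>x\<in>X. w x * f x)"

text \<open>Weight vectors are indexed by the points themselves: \<open>\<real>\<^sup>n\<close> becomes \<open>X \<rightarrow>\<^sub>E UNIV\<close>.\<close>

definition opt_weights ::
    "(real \<Rightarrow> real) set \<Rightarrow> ((real \<Rightarrow> real) \<Rightarrow> (real \<Rightarrow> real) \<Rightarrow> real) \<Rightarrow> real \<Rightarrow>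
     real set \<Rightarrow> real \<Rightarrow> real" where
  "opt_weights H ip \<alpha> X =
     arg_min (\<lambda>w. worst_case_error H ip \<alpha> (quadrature X w)) (\<lambda>w. w \<in> X \<rightarrow>\<^sub>E UNIV)"

definition opt_quadrature ::
    "(real \<Rightarrow> real) set \<Rightarrow> ((real \<Rightarrow> real) \<Rightarrow> (real \<Rightarrow> real) \<Rightarrow> real) \<Rightarrow> real \<Rightarrow>
     real set \<Rightarrow> (real \<Rightarrow> real) \<Rightarrow> real" where
  "opt_quadrature H ip \<alpha> X = quadrature X (opt_weights H ip \<alpha> X)"

definition interpolant ::
    "('a \<Rightarrow> real) set \<Rightarrow> (('a \<Rightarrow> real) \<Rightarrow> ('a \<Rightarrow> real) \<Rightarrow> real) \<Rightarrow> 'a set \<Rightarrow>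
     ('a \<Rightarrow> real) \<Rightarrow> 'a \<Rightarrow> real" where
  "interpolant H ip X f = arg_min (fun_norm ip) (\<lambda>g. g \<in> H \<and> (\<forall>x\<in>X. g x = f x))"

definition power_function ::
    "('a \<Rightarrow> real) set \<Rightarrow> (('a \<Rightarrow> real) \<Rightarrow> ('a \<Rightarrow> real) \<Rightarrow> real) \<Rightarrow> 'a set \<Rightarrow> 'a \<Rightarrow> ennreal" where
  "power_function H ip X x =
     (SUP f\<in>{f \<in> H. fun_norm ip f \<le> 1}. ennreal \<bar>f x - interpolant H ip X f x\<bar>)"

text \<open>For \<open>\<Omega> \<noteq> {}\<close> this is \<open>\<infinity>\<close> if \<open>X \<inter> \<Omega> = {}\<close>, as the empty infimum in \<^typ>\<open>ennreal\<close> is \<open>\<infinity>\<close>.\<close>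

definition fill_distance :: "real set \<Rightarrow> real set \<Rightarrow> ennreal" where
  "fill_distance X \<Omega> = (SUP x\<in>\<Omega>. INF y\<in>X \<inter> \<Omega>. ennreal \<bar>x - y\<bar>)"

definition power_function_bound ::
    "(real \<Rightarrow> real) set \<Rightarrow> ((real \<Rightarrow> real) \<Rightarrow> (real \<Rightarrow> real) \<Rightarrow> real) \<Rightarrow> real \<Rightarrow> real \<Rightarrow> bool" where
  "power_function_bound H ip A h\<^sub>0 \<longleftrightarrow>
     (\<forall>a X. finite X \<longrightarrow> fill_distance X {a..a + 1} \<le> ennreal h\<^sub>0 \<longrightarrow>
        (\<integral>\<^sup>+x\<in>{a..a + 1}. power_function H ip X x \<partial>lborel)
          \<le> ennreal (let h = enn2real (fill_distance X {a..a + 1}) in exp (A * ln h * inverse h)))"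

definition shift_pos :: "(nat \<Rightarrow> real set) \<Rightarrow> nat \<Rightarrow> nat \<Rightarrow> real set" where
  "shift_pos Y p q = {x + real q - 1 |x. x \<in> Y p}"

definition shift_neg :: "(nat \<Rightarrow> real set) \<Rightarrow> nat \<Rightarrow> nat \<Rightarrow> real set" where
  "shift_neg Y p q = {x - real q |x. x \<in> Y p}"

definition nodes :: "(nat \<Rightarrow> real set) \<Rightarrow> nat \<Rightarrow> real set" where
  "nodes Y k = (\<Union>m\<in>{1..k}. shift_pos Y (k - m + 1) m \<union> shift_neg Y (k - m + 1) m)"

end

theory Submission
  imports Defs "HOL-Probability.Distributions"
begin

text \<open>
  Let \<open>s f\<close> be the minimum norm interpolant of \<open>f\<close> on the nodes \<open>X\<close>. The rule \<open>f \<mapsto> I(s f)\<close> has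
  optimal weights: for any rule \<open>Q\<close> on \<open>X\<close>, the function \<open>f - s f\<close> vanishes on \<open>X\<close>, so
  \<open>I f - I(s f) = (I - Q)(f - s f)\<close>, and \<open>f - s f\<close> has norm at most that of \<open>f\<close>. The error is thus
  bounded by the Gaussian integral of the power function, which we split into unit intervals.
  On the two intervals whose points have modulus in \<open>[j, j + 1]\<close> the Gaussian weight is
  \<open>O(exp(-2 B j))\<close>, and since these intervals contain translates of \<open>Y\<^bsub>k-j\<^esub>\<close> the power function
  integrates to \<open>O(exp(-B (k - j)))\<close>, where \<open>B\<close> is arbitrary because both bounds are in fact
  superexponential. Summing the products gives \<open>O(exp(-B k))\<close>, while \<open>n \<le> k (k + 1)\<close>.
\<close>

section \<open>Interpolation in reproducing kernel Hilbert spaces\<close>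

context rkhs
begin

section \<open>Inner product identities from the locale axioms\<close>

lemma diff_mem: "f \<in> H \<Longrightarrow> g \<in> H \<Longrightarrow> (\<lambda>x. f x - g x) \<in> H"
  using add_mem[OF _ scale_mem[of g "-1"], of f] by simp

lemma ip_diff:
  assumes "f \<in> H" "g \<in> H" "h \<in> H"
  shows "ip (\<lambda>x. f x - g x) h = ip f h - ip g h"
  using ip_add[OF assms(1) scale_mem[OF assms(2), of "-1"] assms(3)]
    ip_scale[OF assms(2,3), of "-1"] by simp

lemma ip_zero: "h \<in> H \<Longrightarrow> ip (\<lambda>x. 0) h = 0"
  using ip_scale[OF zero_mem, of h 0] by simp

lemma sum_mem:
  assumes "finite X" "\<And>x. x \<in> X \<Longrightarrow> u x \<in> H"
  shows "(\<lambda>z. \<Sum>x\<in>X. c x * u x z) \<in> H"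
  using assms
proof (induction X)
  case empty
  then show ?case using zero_mem by simp
next
  case (insert y X)
  then show ?case
    using add_mem[OF scale_mem[of "u y" "c y"], of "\<lambda>z. \<Sum>x\<in>X. c x * u x z"] by simp
qed

lemma ip_sum:
  assumes "finite X" "\<And>x. x \<in> X \<Longrightarrow> u x \<in> H" "h \<in> H"
  shows "ip (\<lambda>z. \<Sum>x\<in>X. c x * u x z) h = (\<Sum>x\<in>X. c x * ip (u x) h)"
  using assms
proof (induction X)
  case empty
  then show ?case using ip_zero by simp
next
  case (insert y X)
  then have "u y \<in> H" "(\<lambda>z. \<Sum>x\<in>X. c x * u x z) \<in> H"
    using sum_mem[of X u c] by auto
  then show ?case
    using insert ip_add[OF scale_mem[of "u y" "c y"], of "\<lambda>z. \<Sum>x\<in>X. c x * u x z" h]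
    by (simp add: ip_scale)
qed

lemma ip_diff_self:
  assumes "f \<in> H" "g \<in> H"
  shows "ip (\<lambda>x. f x - g x) (\<lambda>x. f x - g x) = ip f f - 2 * ip f g + ip g g"
proof -
  let ?d = "\<lambda>x. f x - g x"
  have d: "?d \<in> H" using assms by (rule diff_mem)
  have "ip ?d ?d = ip ?d f - ip ?d g"
    using ip_diff[OF assms d] ip_commute[OF assms(1) d] ip_commute[OF assms(2) d] by simp
  then show ?thesis
    using ip_diff[OF assms assms(1)] ip_diff[OF assms assms(2)] ip_commute[OF assms] by simp
qed

lemma Cauchy_Schwarz:
  assumes "f \<in> H" "g \<in> H"
  shows "\<bar>ip f g\<bar> \<le> fun_norm ip f * fun_norm ip g"
proof -
  have "(ip f g)\<^sup>2 \<le> ip f f * ip g g"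
  proof (cases "ip g g = 0")
    case True
    then have "g = (\<lambda>x. 0)" using ip_definite assms by blast
    then have "ip f g = 0" using ip_commute[OF assms] ip_zero[OF assms(1)] by simp
    then show ?thesis using True by simp
  next
    case False
    then have pos: "ip g g > 0" using ip_nonneg[OF assms(2)] by simp
    \<comment> \<open>\<open>t g\<close> is the orthogonal projection of \<open>f\<close> onto the
      line through \<open>g\<close>; nonnegativity of the squared residual is the
      inequality.\<close>
    define t where "t = ip f g / ip g g"
    have tg: "(\<lambda>x. t * g x) \<in> H" using assms(2) by (rule scale_mem)
    have "ip f (\<lambda>x. t * g x) = t * ip f g"
      using ip_commute[OF assms(1) tg] ip_scale[OF assms(2,1), of t] ip_commute[OF assms] by simp
    moreover have "ip (\<lambda>x. t * g x) (\<lambda>x. t * g x) = t * (t * ip g g)"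
      using ip_scale[OF assms(2) tg, of t] ip_scale[OF assms(2,2), of t] ip_commute[OF assms(2) tg]
      by simp
    ultimately have "0 \<le> ip f f - 2 * (t * ip f g) + t * (t * ip g g)"
      using ip_nonneg[OF diff_mem[OF assms(1) tg]] ip_diff_self[OF assms(1) tg] by simp
    also have "\<dots> = ip f f - (ip f g)\<^sup>2 / ip g g"
      using pos by (simp add: t_def power2_eq_square)
    finally show ?thesis using pos by (simp add: field_simps)
  qed
  then show ?thesis
    unfolding fun_norm_def real_sqrt_mult[symmetric] by (simp add: real_le_rsqrt)
qed

text \<open>Point evaluation is pairing with the kernel section at \<open>x\<close>, whose squared
  norm is \<open>K x x\<close>. For the Gaussian kernel this is 1, so the norm of \<open>H\<close>
  dominates the supremum norm.\<close>

lemma abs_le_fun_norm: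
  assumes "f \<in> H"
  shows "\<bar>f x\<bar> \<le> fun_norm ip f * sqrt (K x x)"
proof -
  have "ip (\<lambda>z. K z x) (\<lambda>z. K z x) = K x x"
    using reproducing[OF kernel_mem[of x], of x] by simp
  then show ?thesis
    using Cauchy_Schwarz[OF assms kernel_mem[of x]] reproducing[OF assms, of x]
    by (simp add: fun_norm_def)
qed

text \<open>
  The induction is a Gram-Schmidt step: the residual \<open>r\<close> of the kernel at a new point \<open>y\<close> is either zero, in which
  case \<open>y\<close> imposes no new condition, or it satisfies \<open>r y = \<parallel>r\<parallel>\<^sup>2 > 0\<close>.
\<close>

lemma exists_cardinal_functions:
  assumes "finite X"
  shows "\<exists>u. (\<forall>x\<in>X. u x \<in> H) \<and>
    (\<forall>x\<in>X. \<forall>h\<in>H. (\<forall>z\<in>X. h z = 0) \<longrightarrow> ip (u x) h = 0) \<and>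
    (\<forall>f\<in>H. \<forall>z\<in>X. (\<Sum>x\<in>X. f x * u x z) = f z)"
  using assms
proof (induction X)
  case empty
  then show ?case by simp
next
  case (insert y X)
  then obtain u where u0: "\<forall>x\<in>X. u x \<in> H"
    "\<forall>x\<in>X. \<forall>h\<in>H. (\<forall>z\<in>X. h z = 0) \<longrightarrow> ip (u x) h = 0"
    "\<forall>f\<in>H. \<forall>z\<in>X. (\<Sum>x\<in>X. f x * u x z) = f z"
    by (elim exE conjE)
  have u: "u x \<in> H" if "x \<in> X" for x
    using u0(1) that by blast
  have orth: "ip (u x) h = 0" if "x \<in> X" "h \<in> H" "\<And>z. z \<in> X \<Longrightarrow> h z = 0" for x h
    using u0(2) that by blast
  have interp: "(\<Sum>x\<in>X. f x * u x z) = f z" if "f \<in> H" "z \<in> X" for f z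
    using u0(3) that by blast
  define k where "k = (\<lambda>z. K z y)"
  define s where "s = (\<lambda>z. \<Sum>x\<in>X. k x * u x z)"
  define r where "r = (\<lambda>z. k z - s z)"
  have k: "k \<in> H" unfolding k_def by (rule kernel_mem)
  have s: "s \<in> H" unfolding s_def using insert u by (intro sum_mem) auto
  have r: "r \<in> H" unfolding r_def using k s by (rule diff_mem)
  have r0: "r z = 0" if "z \<in> X" for z
    using interp[OF k that] by (simp add: r_def s_def)
  have ips: "ip s h = 0" if "h \<in> H" "\<And>z. z \<in> X \<Longrightarrow> h z = 0" for h
    unfolding s_def using ip_sum[of X u h k] insert u that orth by simp
  \<comment> \<open>Among functions vanishing on \<open>X\<close>, pairing with \<open>r\<close> is
    evaluation at \<open>y\<close>; the choice \<open>h = r\<close> gives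
    \<open>r y = ip r r\<close>.\<close>
  have ipr: "ip r h = h y" if "h \<in> H" "\<And>z. z \<in> X \<Longrightarrow> h z = 0" for h
    using ip_diff[OF k s that(1)] ips[OF that] reproducing[OF that(1), of y]
      ip_commute[OF k that(1)] by (simp add: r_def k_def)
  show ?case
  proof (cases "r y = 0")
    case True
    then have "ip r r = 0" using ipr[OF r] r0 by simp
    then have r00: "r = (\<lambda>x. 0)" using ip_definite r by blast
    have vanish: "h y = 0" if "h \<in> H" "\<And>z. z \<in> X \<Longrightarrow> h z = 0" for h
      using ipr[OF that] ip_zero[OF that(1)] r00 by simp
    \<comment> \<open>The interpolation error vanishes on \<open>X\<close>, hence at
      \<open>y\<close> too. The old functions thus already match \<open>f\<close> at
      \<open>y\<close>, and the function attached to \<open>y\<close> can be zero.\<close>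
    have at_y: "(\<Sum>x\<in>X. f x * u x y) = f y" if f: "f \<in> H" for f
      using vanish[OF diff_mem[OF sum_mem[of X u f] f]] insert u interp[OF f] by simp
    define u' where "u' = u(y := (\<lambda>x. 0))"
    have [simp]: "(\<Sum>x\<in>insert y X. f x * u' x z) = (\<Sum>x\<in>X. f x * u x z)" for f z
      using insert by (auto simp: u'_def intro!: sum.cong)
    have "u' x \<in> H" if "x \<in> insert y X" for x
      using that u zero_mem by (auto simp: u'_def)
    moreover have "ip (u' x) h = 0" if "x \<in> insert y X" "h \<in> H" "\<forall>z\<in>insert y X. h z = 0" for x h
      using that orth[of x h] ip_zero[of h] by (auto simp: u'_def)
    moreover have "(\<Sum>x\<in>insert y X. f x * u' x z) = f z" if "f \<in> H" "z \<in> insert y X" for f z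
      using that interp[of f z] at_y[of f] by auto
    ultimately show ?thesis by blast
  next
    case False
    define v where "v = (\<lambda>z. inverse (r y) * r z)"
    have v: "v \<in> H" unfolding v_def using r by (rule scale_mem)
    have ipv: "ip v h = 0" if "h \<in> H" "\<And>z. z \<in> insert y X \<Longrightarrow> h z = 0" for h
      using ip_scale[OF r that(1), of "inverse (r y)"] ipr[OF that(1)] that(2)
      by (simp add: v_def)
    have v_y: "v y = 1" and v0: "\<And>z. z \<in> X \<Longrightarrow> v z = 0"
      using False r0 by (auto simp: v_def)
    \<comment> \<open>Since \<open>v\<close> is 1 at \<open>y\<close> and 0 on \<open>X\<close>, the
      correction makes each old function vanish at \<open>y\<close> without changing its values on
      \<open>X\<close>.\<close>
    define u' where "u' = (\<lambda>x. if x = y then v else (\<lambda>z. u x z - u x y * v z))"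
    have u': "u' x \<in> H" if "x \<in> insert y X" for x
      using that u v by (auto simp: u'_def intro!: diff_mem scale_mem)
    have orth': "ip (u' x) h = 0"
      if "x \<in> insert y X" "h \<in> H" "\<And>z. z \<in> insert y X \<Longrightarrow> h z = 0" for x h
      using that u v ipv[OF that(2,3)] orth
      by (auto simp: u'_def ip_diff ip_scale scale_mem)
    \<comment> \<open>Newton form: the old interpolant plus its defect at \<open>y\<close> times
      \<open>v\<close>.\<close>
    have eq: "(\<Sum>x\<in>insert y X. f x * u' x z) =
        (\<Sum>x\<in>X. f x * u x z) + (f y - (\<Sum>x\<in>X. f x * u x y)) * v z" for f z
    proof -
      have "(\<Sum>x\<in>X. f x * u' x z) = (\<Sum>x\<in>X. f x * u x z - f x * u x y * v z)"
        using insert by (intro sum.cong) (auto simp: u'_def algebra_simps)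
      also have "\<dots> = (\<Sum>x\<in>X. f x * u x z) - (\<Sum>x\<in>X. f x * u x y) * v z"
        by (simp add: sum_subtractf sum_distrib_right)
      finally have "(\<Sum>x\<in>insert y X. f x * u' x z) =
          f y * v z + ((\<Sum>x\<in>X. f x * u x z) - (\<Sum>x\<in>X. f x * u x y) * v z)"
        using insert(1,2) by (simp add: u'_def)
      then show ?thesis by (simp only: left_diff_distrib)
    qed
    have "(\<Sum>x\<in>insert y X. f x * u' x z) = f z" if "f \<in> H" "z \<in> insert y X" for f z
      using that interp[OF that(1)] v_y v0 unfolding eq by auto
    then show ?thesis
      using u' orth' by (intro exI[of _ u']) blast
  qed
qed

text \<open>An analogue of the Lagrange basis. Orthogonality to everything vanishing on
  \<open>X\<close> is what makes the interpolating sum norm-minimal. The interpolation clause speaks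
  only of values of members of \<open>H\<close>, since for a general \<open>K\<close> the values at
  the points of \<open>X\<close> may be linearly dependent.\<close>

definition cardinal_functions :: "'a set \<Rightarrow> 'a \<Rightarrow> 'a \<Rightarrow> real" where
  "cardinal_functions X = (SOME u. (\<forall>x\<in>X. u x \<in> H) \<and>
    (\<forall>x\<in>X. \<forall>h\<in>H. (\<forall>z\<in>X. h z = 0) \<longrightarrow> ip (u x) h = 0) \<and>
    (\<forall>f\<in>H. \<forall>z\<in>X. (\<Sum>x\<in>X. f x * u x z) = f z))"

lemma
  assumes "finite X"
  shows cardinal_functions_mem: "x \<in> X \<Longrightarrow> cardinal_functions X x \<in> H"
    and cardinal_functions_orthogonal:
      "x \<in> X \<Longrightarrow> h \<in> H \<Longrightarrow> (\<And>z. z \<in> X \<Longrightarrow> h z = 0) \<Longrightarrow> ip (cardinal_functions X x) h = 0"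
    and cardinal_functions_interpolate:
      "f \<in> H \<Longrightarrow> z \<in> X \<Longrightarrow> (\<Sum>x\<in>X. f x * cardinal_functions X x z) = f z"
  using someI_ex[OF exists_cardinal_functions[OF assms], folded cardinal_functions_def]
  by blast+

text \<open>By Pythagoras: a competitor \<open>g\<close> differs from the sum by a function
  vanishing on \<open>X\<close>, which is orthogonal to the sum. This gives minimality and also
  uniqueness, so the choice made by \<open>arg_min\<close> is determined.\<close>

lemma interpolant_eq_sum:
  assumes X: "finite X" and f: "f \<in> H"
  shows "interpolant H ip X f = (\<lambda>z. \<Sum>x\<in>X. f x * cardinal_functions X x z)" (is "_ = ?s")
proof -
  have s: "?s \<in> H"
    using X by (intro sum_mem cardinal_functions_mem) auto
  have s_eq: "?s z = f z" if "z \<in> X" for z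
    using cardinal_functions_interpolate[OF X f that] .
  have pyth: "ip g g = ip ?s ?s + ip (\<lambda>x. g x - ?s x) (\<lambda>x. g x - ?s x)"
    if g: "g \<in> H" "\<And>z. z \<in> X \<Longrightarrow> g z = f z" for g
  proof -
    have d: "(\<lambda>x. g x - ?s x) \<in> H" using g s by (intro diff_mem)
    have "ip ?s (\<lambda>x. g x - ?s x) = (\<Sum>x\<in>X. f x * ip (cardinal_functions X x) (\<lambda>x. g x - ?s x))"
      using X d by (intro ip_sum cardinal_functions_mem) auto
    also have "\<dots> = 0"
      using cardinal_functions_orthogonal[OF X _ d] g s_eq by (intro sum.neutral) simp
    finally have "ip g ?s = ip ?s ?s"
      using ip_diff[OF g(1) s s] ip_commute[OF s d] by simp
    then show ?thesis using ip_diff_self[OF g(1) s] by simp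
  qed
  have min: "\<not> fun_norm ip g < fun_norm ip ?s" if "g \<in> H" "\<And>z. z \<in> X \<Longrightarrow> g z = f z" for g
    using pyth[OF that] ip_nonneg[OF diff_mem[OF that(1) s]] by (simp add: fun_norm_def not_less)
  show ?thesis
    unfolding interpolant_def
  proof (rule arg_minI[where Q = "\<lambda>g. g = ?s"])
    show "?s \<in> H \<and> (\<forall>x\<in>X. ?s x = f x)" using s s_eq by blast
    show "\<not> fun_norm ip g < fun_norm ip ?s" if "g \<in> H \<and> (\<forall>x\<in>X. g x = f x)" for g
      using min that by blast
    fix g
    assume g: "g \<in> H \<and> (\<forall>x\<in>X. g x = f x)"
      and "\<forall>h. h \<in> H \<and> (\<forall>x\<in>X. h x = f x) \<longrightarrow> \<not> fun_norm ip h < fun_norm ip g"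
    then have "fun_norm ip g \<le> fun_norm ip ?s" using s s_eq not_less by blast
    then have "ip (\<lambda>x. g x - ?s x) (\<lambda>x. g x - ?s x) \<le> 0"
      using pyth[of g] g by (simp add: fun_norm_def)
    moreover have d: "(\<lambda>x. g x - ?s x) \<in> H" using g s by (intro diff_mem) auto
    ultimately have "ip (\<lambda>x. g x - ?s x) (\<lambda>x. g x - ?s x) = 0"
      using ip_nonneg by (meson order_antisym)
    then have "(\<lambda>x. g x - ?s x) = (\<lambda>x. 0)" using ip_definite d by blast
    then show "g = ?s" by (metis (no_types, lifting) ext eq_iff_diff_eq_0)
  qed
qed

lemma interpolant_mem: "finite X \<Longrightarrow> f \<in> H \<Longrightarrow> interpolant H ip X f \<in> H"
  by (simp add: interpolant_eq_sum sum_mem cardinal_functions_mem)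

lemma interpolant_eq: "finite X \<Longrightarrow> f \<in> H \<Longrightarrow> z \<in> X \<Longrightarrow> interpolant H ip X f z = f z"
  by (simp add: interpolant_eq_sum cardinal_functions_interpolate)

text \<open>The interpolant is orthogonal to \<open>f\<close> minus the interpolant, so this
  difference is an orthogonal projection of \<open>f\<close>.\<close>

lemma fun_norm_diff_interpolant_le:
  assumes X: "finite X" and f: "f \<in> H"
  shows "fun_norm ip (\<lambda>x. f x - interpolant H ip X f x) \<le> fun_norm ip f"
proof -
  let ?s = "interpolant H ip X f"
  have s: "?s \<in> H" using X f by (rule interpolant_mem)
  have d: "(\<lambda>x. f x - ?s x) \<in> H" using f s by (rule diff_mem)
  have "ip ?s (\<lambda>x. f x - ?s x) = (\<Sum>x\<in>X. f x * ip (cardinal_functions X x) (\<lambda>x. f x - ?s x))"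
    using ip_sum[OF X _ d, of "cardinal_functions X" f] cardinal_functions_mem[OF X]
      interpolant_eq_sum[OF X f] by simp
  also have "\<dots> = 0"
    using cardinal_functions_orthogonal[OF X _ d] interpolant_eq[OF X f]
    by (intro sum.neutral) simp
  finally have "ip f ?s = ip ?s ?s"
    using ip_diff[OF f s s] ip_commute[OF s d] by simp
  then show ?thesis
    using ip_diff_self[OF f s] ip_nonneg[OF s] by (simp add: fun_norm_def)
qed

end

section \<open>Fill distance\<close>

text \<open>Finiteness of \<open>X\<close> makes the infimum attained, and an empty intersection
  gives the infimum \<open>top\<close>, which no real bounds. The inequality stays in
  \<open>ennreal\<close> because \<open>r\<close> may be negative, where \<open>ennreal r\<close> is
  0.\<close>

lemma fill_distance_le_iff:
  assumes "finite X"
  shows "fill_distance X \<Omega> \<le> ennreal r \<longleftrightarrow> (\<forall>x\<in>\<Omega>. \<exists>y\<in>X \<inter> \<Omega>. ennreal \<bar>x - y\<bar> \<le> ennreal r)"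
proof -
  have "(INF y\<in>X \<inter> \<Omega>. ennreal \<bar>x - y\<bar>) \<le> ennreal r \<longleftrightarrow>
      (\<exists>y\<in>X \<inter> \<Omega>. ennreal \<bar>x - y\<bar> \<le> ennreal r)" for x
  proof
    assume le: "(INF y\<in>X \<inter> \<Omega>. ennreal \<bar>x - y\<bar>) \<le> ennreal r"
    then have ne: "X \<inter> \<Omega> \<noteq> {}" by (auto simp: top_unique)
    then have "(INF y\<in>X \<inter> \<Omega>. ennreal \<bar>x - y\<bar>) = Min ((\<lambda>y. ennreal \<bar>x - y\<bar>) ` (X \<inter> \<Omega>))"
      using assms by (intro cInf_eq_Min) auto
    also have "\<dots> \<in> (\<lambda>y. ennreal \<bar>x - y\<bar>) ` (X \<inter> \<Omega>)"
      using assms ne by (intro Min_in) auto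
    finally show "\<exists>y\<in>X \<inter> \<Omega>. ennreal \<bar>x - y\<bar> \<le> ennreal r" using le by auto
  qed (auto intro: INF_lower2)
  then show ?thesis by (simp add: fill_distance_def SUP_le_iff)
qed

text \<open>Fill distance 0 would put \<Omega> inside the finite set \<open>X\<close>. Positivity
  matters because at \<open>h = 0\<close> the convention \<open>inverse 0 = 0\<close> would turn the
  assumed bound into \<open>exp 0 = 1\<close>.\<close>

lemma fill_distance_pos:
  assumes "finite X" "infinite \<Omega>"
  shows "fill_distance X \<Omega> > 0"
proof (rule ccontr)
  assume "\<not> ?thesis"
  then have "fill_distance X \<Omega> \<le> ennreal 0" by simp
  then have "\<Omega> \<subseteq> X"
    unfolding fill_distance_le_iff[OF assms(1)] by (auto simp: ennreal_le_iff2)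
  then show False using assms finite_subset by blast
qed

text \<open>Additional nodes only decrease the distance. The passage from the open interval to the
  closed one approximates end points by interior points, at an arbitrarily small cost
  \<open>e\<close>.\<close>

lemma fill_distance_translate_le:
  assumes "finite X" "finite Y" "Y \<subseteq> {0<..<1}" "(\<lambda>y. y + a) ` Y \<subseteq> X" "r \<ge> 0"
    and fill: "fill_distance Y {0<..<1} \<le> ennreal r"
  shows "fill_distance X {a..a + 1} \<le> ennreal r"
proof -
  have Y: "\<exists>y\<in>Y. \<bar>x - y\<bar> \<le> r" if "0 < x" "x < 1" for x
    using fill that \<open>r \<ge> 0\<close> unfolding fill_distance_le_iff[OF assms(2)] by auto
  have "(INF y\<in>X \<inter> {a..a + 1}. ennreal \<bar>x - y\<bar>) \<le> ennreal r" if x: "x \<in> {a..a + 1}" for x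
  proof (rule ennreal_le_epsilon)
    fix e :: real
    assume e: "e > 0"
    \<comment> \<open>A move towards the midpoint, by at most \<open>1 / 4\<close> so as to stay
      inside the open interval.\<close>
    define x' where "x' = (if x - a \<le> 1 / 2 then x - a + min e (1 / 4) else x - a - min e (1 / 4))"
    have x': "0 < x'" "x' < 1" "\<bar>x - a - x'\<bar> \<le> e"
      using x e by (auto simp: x'_def min_def split: if_splits)
    obtain y where y: "y \<in> Y" "\<bar>x' - y\<bar> \<le> r" using Y[OF x'(1,2)] by blast
    have "y + a \<in> X \<inter> {a..a + 1}" using y assms by auto
    then have "(INF y\<in>X \<inter> {a..a + 1}. ennreal \<bar>x - y\<bar>) \<le> ennreal \<bar>x - (y + a)\<bar>"
      by (rule INF_lower)
    also have "\<dots> \<le> ennreal (r + e)"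
      using x' y by (intro ennreal_leI) linarith
    also have "\<dots> = ennreal r + ennreal e" using e \<open>r \<ge> 0\<close> by simp
    finally show "(INF y\<in>X \<inter> {a..a + 1}. ennreal \<bar>x - y\<bar>) \<le> ennreal r + ennreal e" .
  qed
  then show ?thesis by (auto simp: fill_distance_def SUP_le_iff)
qed

section \<open>The Gaussian kernel\<close>

lemma gauss_kernel_self [simp]: "gauss_kernel l x x = 1"
  by (simp add: gauss_kernel_def)

lemma rkhs_gauss_abs_le:
  assumes "rkhs (gauss_kernel l) H ip" "f \<in> H"
  shows "\<bar>f x\<bar> \<le> fun_norm ip f"
  using rkhs.abs_le_fun_norm[OF assms, of x] by simp

text \<open>Cauchy-Schwarz bounds \<open>f y - f x\<close> by the norm of \<open>f\<close> times the
  distance of two kernel sections, whose square is \<open>2 - 2 * gauss_kernel l y x\<close>.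
  Continuity supplies the measurability that the integrals require.\<close>

lemma rkhs_gauss_continuous:
  assumes "rkhs (gauss_kernel l) H ip" and f: "f \<in> H"
  shows "continuous_on UNIV f"
proof -
  interpret rkhs "gauss_kernel l" H ip by fact
  have "(f \<longlongrightarrow> f x) (at x)" for x
  proof -
    let ?k = "\<lambda>y z. gauss_kernel l z y"
    have "\<bar>f y - f x\<bar> \<le> fun_norm ip f * sqrt (2 - 2 * gauss_kernel l y x)" for y
    proof -
      have "ip (\<lambda>z. ?k y z - ?k x z) (\<lambda>z. ?k y z - ?k x z) = 2 - 2 * gauss_kernel l y x"
        using ip_diff_self[OF kernel_mem[of y] kernel_mem[of x]]
          reproducing[OF kernel_mem[of y], of x] reproducing[OF kernel_mem[of x], of x]
          reproducing[OF kernel_mem[of y], of y]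
        by (simp add: gauss_kernel_def power2_commute)
      moreover have "f y - f x = ip f (\<lambda>z. ?k y z - ?k x z)"
        using reproducing[OF f, of y] reproducing[OF f, of x]
          ip_commute[OF f diff_mem[OF kernel_mem[of y] kernel_mem[of x]]]
          ip_diff[OF kernel_mem[of y] kernel_mem[of x] f]
          ip_commute[OF f kernel_mem[of x]] ip_commute[OF f kernel_mem[of y]] by simp
      ultimately show ?thesis
        using Cauchy_Schwarz[OF f diff_mem[OF kernel_mem[of y] kernel_mem[of x]]]
        by (simp add: fun_norm_def)
    qed
    moreover have "((\<lambda>y. fun_norm ip f * sqrt (2 - 2 * gauss_kernel l y x)) \<longlongrightarrow>
        fun_norm ip f * sqrt (2 - 2 * gauss_kernel l x x)) (at x)"
      unfolding gauss_kernel_def divide_inverse by (intro tendsto_intros)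
    ultimately have "((\<lambda>y. f y - f x) \<longlongrightarrow> 0) (at x)"
      by (intro Lim_null_comparison[of "\<lambda>y. f y - f x"
            "\<lambda>y. fun_norm ip f * sqrt (2 - 2 * gauss_kernel l y x)"]) auto
    then show ?thesis by (rule LIM_zero_cancel)
  qed
  then show ?thesis by (simp add: continuous_on_def)
qed

section \<open>Integration against the Gaussian weight\<close>

lemma integrable_gauss_weight:
  fixes \<alpha> :: real
  assumes "\<alpha> > 0"
  shows "integrable lborel (\<lambda>x. exp (- (x\<^sup>2) / (2 * \<alpha>\<^sup>2)))"
proof -
  have "integrable lborel (\<lambda>x. sqrt (2 * pi * \<alpha>\<^sup>2) * normal_density 0 \<alpha> x)"
    using assms by simp
  moreover have "(\<lambda>x. sqrt (2 * pi * \<alpha>\<^sup>2) * normal_density 0 \<alpha> x) =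
      (\<lambda>x. exp (- (x\<^sup>2) / (2 * \<alpha>\<^sup>2)))"
    using assms by (auto simp: normal_density_def)
  ultimately show ?thesis by simp
qed

lemma rkhs_gauss_integrable:
  assumes "rkhs (gauss_kernel l) H ip" "\<alpha> > 0" "f \<in> H"
  shows "integrable lborel (\<lambda>x. f x * exp (- (x\<^sup>2) / (2 * \<alpha>\<^sup>2)))"
proof (rule Bochner_Integration.integrable_bound)
  show "integrable lborel (\<lambda>x. fun_norm ip f * exp (- (x\<^sup>2) / (2 * \<alpha>\<^sup>2)))"
    using integrable_gauss_weight[OF assms(2)] by simp
  have "f \<in> borel_measurable borel"
    using rkhs_gauss_continuous[OF assms(1,3)] by (rule borel_measurable_continuous_onI)
  then show "(\<lambda>x. f x * exp (- (x\<^sup>2) / (2 * \<alpha>\<^sup>2))) \<in> borel_measurable lborel"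
    by simp
  show "AE x in lborel. norm (f x * exp (- (x\<^sup>2) / (2 * \<alpha>\<^sup>2)))
      \<le> norm (fun_norm ip f * exp (- (x\<^sup>2) / (2 * \<alpha>\<^sup>2)))"
    using order_trans[OF rkhs_gauss_abs_le[OF assms(1,3)] abs_ge_self]
    by (auto simp: abs_mult)
qed

lemma rkhs_gauss_integral_diff:
  assumes "rkhs (gauss_kernel l) H ip" "\<alpha> > 0" "f \<in> H" "g \<in> H"
  shows "gauss_integral \<alpha> (\<lambda>x. f x - g x) = gauss_integral \<alpha> f - gauss_integral \<alpha> g"
  using rkhs_gauss_integrable[OF assms(1,2,3)] rkhs_gauss_integrable[OF assms(1,2,4)]
  by (simp add: gauss_integral_def left_diff_distrib diff_divide_distrib)

lemma rkhs_gauss_integral_sum: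
  assumes "rkhs (gauss_kernel l) H ip" "\<alpha> > 0" "\<And>x. x \<in> X \<Longrightarrow> u x \<in> H"
  shows "gauss_integral \<alpha> (\<lambda>z. \<Sum>x\<in>X. c x * u x z) = (\<Sum>x\<in>X. c x * gauss_integral \<alpha> (u x))"
  using rkhs_gauss_integrable[OF assms(1,2,3)]
  by (simp add: gauss_integral_def sum_distrib_right sum_distrib_left mult.assoc mult.left_commute)

text \<open>Integrating the interpolant is itself a rule on \<open>X\<close>, with the integrals of
  the cardinal functions as weights. \<open>arg_min\<close> is meaningful only if a minimiser
  exists, so these weights are shown to be one.\<close>

lemma worst_case_error_opt_le:
  assumes R: "rkhs (gauss_kernel l) H ip" and "\<alpha> > 0" and X: "finite X"
    and bound: "\<And>f. f \<in> H \<Longrightarrow> fun_norm ip f \<le> 1 \<Longrightarrow>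
      ennreal \<bar>gauss_integral \<alpha> (\<lambda>x. f x - interpolant H ip X f x)\<bar> \<le> b"
  shows "worst_case_error H ip \<alpha> (opt_quadrature H ip \<alpha> X) \<le> b"
proof -
  interpret rkhs "gauss_kernel l" H ip by fact
  define w where "w = restrict (\<lambda>x. gauss_integral \<alpha> (cardinal_functions X x)) X"
  have err: "gauss_integral \<alpha> f - quadrature X w f =
      gauss_integral \<alpha> (\<lambda>x. f x - interpolant H ip X f x)" if f: "f \<in> H" for f
  proof -
    have "quadrature X w f = gauss_integral \<alpha> (interpolant H ip X f)"
      unfolding interpolant_eq_sum[OF X f]
      using rkhs_gauss_integral_sum[OF R assms(2) cardinal_functions_mem[OF X], of X "\<lambda>x. x" f]
      by (simp add: quadrature_def w_def mult.commute)
    then show ?thesis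
      using rkhs_gauss_integral_diff[OF R assms(2) f interpolant_mem[OF X f]] by simp
  qed
  \<comment> \<open>The competing rule is tested on the interpolation error of \<open>f\<close>,
    where it returns 0.\<close>
  have opt: "worst_case_error H ip \<alpha> (quadrature X w) \<le> worst_case_error H ip \<alpha> (quadrature X v)" for v
    unfolding worst_case_error_def[of H ip \<alpha> "quadrature X w"]
  proof (rule SUP_least, clarify)
    fix f
    assume f: "f \<in> H" "fun_norm ip f \<le> 1"
    let ?d = "\<lambda>x. f x - interpolant H ip X f x"
    have "?d \<in> H" using f X by (intro diff_mem interpolant_mem)
    moreover have "fun_norm ip ?d \<le> 1"
      using fun_norm_diff_interpolant_le[OF X f(1)] f(2) by linarith
    ultimately have "ennreal \<bar>gauss_integral \<alpha> ?d - quadrature X v ?d\<bar>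
        \<le> worst_case_error H ip \<alpha> (quadrature X v)"
      unfolding worst_case_error_def by (intro SUP_upper) simp
    moreover have "quadrature X v ?d = 0"
      using interpolant_eq[OF X f(1)] by (simp add: quadrature_def)
    ultimately show "ennreal \<bar>gauss_integral \<alpha> f - quadrature X w f\<bar>
        \<le> worst_case_error H ip \<alpha> (quadrature X v)"
      using err[OF f(1)] by simp
  qed
  have "worst_case_error H ip \<alpha> (quadrature X (opt_weights H ip \<alpha> X))
      \<le> worst_case_error H ip \<alpha> (quadrature X w)"
    unfolding opt_weights_def
  proof (rule arg_minI[where
        Q = "\<lambda>v. worst_case_error H ip \<alpha> (quadrature X v) \<le> worst_case_error H ip \<alpha> (quadrature X w)"])
    show "w \<in> X \<rightarrow>\<^sub>E UNIV" by (simp add: w_def)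
    show "\<not> worst_case_error H ip \<alpha> (quadrature X v) < worst_case_error H ip \<alpha> (quadrature X w)" for v
      using opt[of v] by (simp add: not_less)
    show "worst_case_error H ip \<alpha> (quadrature X v) \<le> worst_case_error H ip \<alpha> (quadrature X w)"
      if "\<forall>v'. v' \<in> X \<rightarrow>\<^sub>E UNIV \<longrightarrow>
        \<not> worst_case_error H ip \<alpha> (quadrature X v') < worst_case_error H ip \<alpha> (quadrature X v)" for v
      using that by (simp add: w_def not_less)
  qed
  also have "\<dots> \<le> b"
    unfolding worst_case_error_def using bound err by (intro SUP_least) auto
  finally show ?thesis by (simp add: opt_quadrature_def)
qed

section \<open>Decay of the power function and of the Gaussian weight\<close>

text \<open>For small \<open>h\<close> the factor \<open>ln h\<close> beats any constant, so every
  exponential rate \<open>B\<close> in \<open>p\<close> is available.\<close>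

lemma power_function_bound_exp:
  assumes "power_function_bound H ip A h\<^sub>0" "A > 0" "h\<^sub>0 > 0" "c > 0" "B \<ge> 0"
  obtains \<delta> where "\<delta> > 0"
    "\<And>a X p. finite X \<Longrightarrow> p > 0 \<Longrightarrow> c / p \<le> \<delta> \<Longrightarrow> fill_distance X {a..a + 1} \<le> ennreal (c / p) \<Longrightarrow>
       (\<integral>\<^sup>+x\<in>{a..a + 1}. power_function H ip X x \<partial>lborel) \<le> ennreal (exp (- B * p))"
proof
  \<comment> \<open>The first entry makes the assumed bound applicable, the second gives
    \<open>A * ln h <= - (B * c)\<close>; then \<open>inverse h >= p / c\<close> finishes.\<close>
  define \<delta> where "\<delta> = min h\<^sub>0 (exp (- (B * c / A)))"
  show "\<delta> > 0" using assms by (simp add: \<delta>_def)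
  fix a p :: real and X :: "real set"
  assume X: "finite X" and p: "p > 0" and le: "c / p \<le> \<delta>"
    and fill: "fill_distance X {a..a + 1} \<le> ennreal (c / p)"
  define h where "h = enn2real (fill_distance X {a..a + 1})"
  \<comment> \<open>Without finiteness \<open>enn2real\<close> would send the fill distance to the
    default value 0.\<close>
  have fin: "fill_distance X {a..a + 1} < top"
    using fill ennreal_less_top le_less_trans by blast
  have h: "h > 0"
    using fill_distance_pos[OF X, of "{a..a + 1}"] fin by (simp add: h_def enn2real_positive_iff)
  have hc: "h \<le> c / p"
    using fill fin assms p by (simp add: h_def enn2real_leI)
  have "ln h \<le> ln (exp (- (B * c / A)))"
    using h hc le by (subst ln_le_cancel_iff) (auto simp: \<delta>_def)
  then have "A * ln h \<le> - (B * c)" using assms by (simp add: field_simps)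
  then have "A * ln h * inverse h \<le> - (B * c) * inverse h"
    using h by (intro mult_right_mono) auto
  also have "\<dots> \<le> - B * p"
  proof -
    have "p \<le> c * inverse h" using hc h p by (simp add: field_simps)
    then have "B * p \<le> B * (c * inverse h)" using assms by (intro mult_left_mono) auto
    then show ?thesis by simp
  qed
  finally have exp: "exp (A * ln h * inverse h) \<le> exp (- B * p)" by simp
  have "fill_distance X {a..a + 1} \<le> ennreal h\<^sub>0"
    using order_trans[OF fill ennreal_leI[of "c / p" h\<^sub>0]] le by (simp add: \<delta>_def)
  then have "(\<integral>\<^sup>+x\<in>{a..a + 1}. power_function H ip X x \<partial>lborel) \<le> ennreal (exp (A * ln h * inverse h))"
    using assms(1) X unfolding power_function_bound_def h_def Let_def by blast
  also have "\<dots> \<le> ennreal (exp (- B * p))" using exp by (intro ennreal_leI)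
  finally show "(\<integral>\<^sup>+x\<in>{a..a + 1}. power_function H ip X x \<partial>lborel) \<le> ennreal (exp (- B * p))" .
qed

lemma set_nn_integral_unit_le_1:
  fixes g :: "real \<Rightarrow> real"
  assumes "\<And>x. g x \<le> 1"
  shows "(\<integral>\<^sup>+x\<in>{a..a + 1}. ennreal (g x) \<partial>lborel) \<le> 1"
proof -
  have "(\<integral>\<^sup>+x\<in>{a..a + 1}. ennreal (g x) \<partial>lborel) \<le> (\<integral>\<^sup>+x. indicator {a..a + 1} x \<partial>lborel)"
    using assms by (intro nn_integral_mono) (auto split: split_indicator)
  also have "\<dots> = 1" by (subst nn_integral_indicator) auto
  finally show ?thesis .
qed

text \<open>The smallness condition on \<open>c / p\<close> is traded for a factor \<open>M\<close>,
  fixed before the nodes and \<open>f\<close>: when it fails, the pointwise error is still at most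
  1.\<close>

lemma interpolation_error_decay:
  assumes R: "rkhs (gauss_kernel l) H ip"
    and "power_function_bound H ip A h\<^sub>0" "A > 0" "h\<^sub>0 > 0" "c > 0" "B \<ge> 0"
  obtains M where "M \<ge> 1"
    "\<And>a X p f. finite X \<Longrightarrow> p > 0 \<Longrightarrow> fill_distance X {a..a + 1} \<le> ennreal (c / p) \<Longrightarrow>
       f \<in> H \<Longrightarrow> fun_norm ip f \<le> 1 \<Longrightarrow>
       (\<integral>\<^sup>+x\<in>{a..a + 1}. ennreal \<bar>f x - interpolant H ip X f x\<bar> \<partial>lborel) \<le> ennreal (M * exp (- B * p))"
proof -
  interpret rkhs "gauss_kernel l" H ip by fact
  obtain \<delta> where \<delta>: "\<delta> > 0" and bound: "\<And>a X p. finite X \<Longrightarrow> p > 0 \<Longrightarrow> c / p \<le> \<delta> \<Longrightarrow>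
      fill_distance X {a..a + 1} \<le> ennreal (c / p) \<Longrightarrow>
      (\<integral>\<^sup>+x\<in>{a..a + 1}. power_function H ip X x \<partial>lborel) \<le> ennreal (exp (- B * p))"
    using power_function_bound_exp[OF assms(2-6)] by blast
  \<comment> \<open>The value of \<open>exp (B * p)\<close> at the threshold
    \<open>p = c / \<delta>\<close>, so that the claimed bound is at least 1 for all smaller
    \<open>p\<close>.\<close>
  define M where "M = exp (B * (c / \<delta>))"
  have M: "M \<ge> 1" using assms \<delta> by (simp add: M_def)
  show thesis
  proof (rule that[OF M])
    fix a p X f
    assume X: "finite X" and p: "p > 0" and fill: "fill_distance X {a..a + 1} \<le> ennreal (c / p)"
      and f: "f \<in> H" "fun_norm ip f \<le> 1"
    let ?d = "\<lambda>x. \<bar>f x - interpolant H ip X f x\<bar>"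
    show "(\<integral>\<^sup>+x\<in>{a..a + 1}. ennreal (?d x) \<partial>lborel) \<le> ennreal (M * exp (- B * p))"
    proof (cases "c / p \<le> \<delta>")
      case True
      have "(\<integral>\<^sup>+x\<in>{a..a + 1}. ennreal (?d x) \<partial>lborel)
          \<le> (\<integral>\<^sup>+x\<in>{a..a + 1}. power_function H ip X x \<partial>lborel)"
        unfolding power_function_def using f
        by (intro nn_integral_mono mult_right_mono SUP_upper) auto
      also have "\<dots> \<le> ennreal (exp (- B * p))" using bound[OF X p True fill] .
      also have "\<dots> \<le> ennreal (M * exp (- B * p))"
        using M by (intro ennreal_leI) simp
      finally show ?thesis .
    next
      case False
      then have "p \<le> c / \<delta>" using p \<delta> by (simp add: field_simps)
      then have "B * p \<le> B * (c / \<delta>)" using assms by (intro mult_left_mono) auto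
      then have "1 \<le> M * exp (- B * p)" by (simp add: M_def exp_add[symmetric])
      then have "1 \<le> ennreal (M * exp (- B * p))" by (simp add: ennreal_le_1 flip: ennreal_1)
      moreover have "?d x \<le> 1" for x
        using rkhs_gauss_abs_le[OF R diff_mem[OF f(1) interpolant_mem[OF X f(1)]], of x]
          fun_norm_diff_interpolant_le[OF X f(1)] f(2) by simp
      ultimately show ?thesis
        using set_nn_integral_unit_le_1[of ?d a] order_trans by blast
    qed
  qed
qed

text \<open>Completing the square: \<open>\<alpha>\<^sup>2 * B\<^sup>2 / 2\<close> is the maximum
  over \<open>j\<close> of \<open>B * j - j\<^sup>2 / (2 * \<alpha>\<^sup>2)\<close>.\<close>

lemma gauss_weight_le:
  fixes \<alpha> B j x :: real
  assumes "\<alpha> > 0" "0 \<le> j" "j \<le> \<bar>x\<bar>"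
  shows "exp (- (x\<^sup>2) / (2 * \<alpha>\<^sup>2)) \<le> exp (\<alpha>\<^sup>2 * B\<^sup>2 / 2) * exp (- (B * j))"
proof -
  have "0 \<le> (j / \<alpha> - \<alpha> * B)\<^sup>2" by simp
  then have "2 * (B * j) \<le> j\<^sup>2 / \<alpha>\<^sup>2 + \<alpha>\<^sup>2 * B\<^sup>2"
    using assms by (simp add: power2_diff power_mult_distrib power_divide mult.commute)
  moreover have "j\<^sup>2 / \<alpha>\<^sup>2 \<le> x\<^sup>2 / \<alpha>\<^sup>2"
    using assms by (intro divide_right_mono) (auto simp: abs_le_square_iff[symmetric])
  ultimately have "- (x\<^sup>2) / (2 * \<alpha>\<^sup>2) \<le> \<alpha>\<^sup>2 * B\<^sup>2 / 2 + - (B * j)"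
    by (simp add: field_simps)
  then show ?thesis by (simp flip: exp_add)
qed

text \<open>Each \<open>x\<close> lies in an interval with index the floor of its modulus. Shared
  end points are counted twice, which is harmless for an upper bound.\<close>

lemma nn_integral_le_suminf_unit_intervals:
  fixes F :: "real \<Rightarrow> ennreal"
  assumes [measurable]: "F \<in> borel_measurable borel"
  shows "(\<integral>\<^sup>+x. F x \<partial>lborel) \<le>
    (\<Sum>j. (\<integral>\<^sup>+x\<in>{real j..real j + 1}. F x \<partial>lborel) + (\<integral>\<^sup>+x\<in>{- real j - 1..- real j}. F x \<partial>lborel))"
proof -
  let ?I = "\<lambda>j. {real j..real j + 1}" and ?J = "\<lambda>j. {- real j - 1..- real j}"
  let ?G = "\<lambda>j x. F x * indicator (?I j) x + F x * indicator (?J j) x"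
  have "F x \<le> (\<Sum>j. ?G j x)" for x
  proof -
    define j where "j = nat \<lfloor>\<bar>x\<bar>\<rfloor>"
    have "x \<in> ?I j \<or> x \<in> ?J j" unfolding j_def by (cases "x \<ge> 0") (auto, linarith+)
    then have "F x \<le> ?G j x" by (auto split: split_indicator)
    also have "\<dots> = (\<Sum>i\<in>{j}. ?G i x)" by simp
    also have "\<dots> \<le> (\<Sum>i. ?G i x)" by (intro sum_le_suminf) auto
    finally show ?thesis .
  qed
  then have "(\<integral>\<^sup>+x. F x \<partial>lborel) \<le> (\<integral>\<^sup>+x. (\<Sum>j. ?G j x) \<partial>lborel)"
    by (intro nn_integral_mono)
  also have "\<dots> = (\<Sum>j. \<integral>\<^sup>+x. ?G j x \<partial>lborel)"
    by (intro nn_integral_suminf) measurable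
  also have "\<dots> = (\<Sum>j. (\<integral>\<^sup>+x\<in>?I j. F x \<partial>lborel) + (\<integral>\<^sup>+x\<in>?J j. F x \<partial>lborel))"
    by (subst nn_integral_add) auto
  finally show ?thesis .
qed

text \<open>The weight is used at rate \<open>2 * B\<close>, so that its product with the error is
  \<open>exp (- B * k) * exp (- B * j)\<close> up to a constant: the first factor is the desired
  decay, the second is summable over \<open>j\<close>.\<close>

lemma gauss_integral_le:
  assumes "\<alpha> > 0" "B > 0" "M \<ge> 1"
    and g: "continuous_on UNIV g" "\<And>x. \<bar>g x\<bar> \<le> 1"
    and pos: "\<And>j. j < k \<Longrightarrow> (\<integral>\<^sup>+x\<in>{real j..real j + 1}. ennreal \<bar>g x\<bar> \<partial>lborel)
      \<le> ennreal (M * exp (- B * real (k - j)))"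
    and neg: "\<And>j. j < k \<Longrightarrow> (\<integral>\<^sup>+x\<in>{- real j - 1..- real j}. ennreal \<bar>g x\<bar> \<partial>lborel)
      \<le> ennreal (M * exp (- B * real (k - j)))"
  shows "ennreal \<bar>gauss_integral \<alpha> g\<bar> \<le> ennreal (1 / (sqrt (2 * pi) * \<alpha>) *
    (2 * exp (2 * \<alpha>\<^sup>2 * B\<^sup>2) * M / (1 - exp (- B))) * exp (- B * real k))"
proof -
  \<comment> \<open>The constant of \<open>gauss_weight_le\<close> at rate
    \<open>2 * B\<close>.\<close>
  define W where "W = exp (2 * \<alpha>\<^sup>2 * B\<^sup>2)"
  have W: "exp (- (x\<^sup>2) / (2 * \<alpha>\<^sup>2)) \<le> W * exp (- (2 * B * j))" if "0 \<le> j" "j \<le> \<bar>x\<bar>" for x j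
    using gauss_weight_le[OF assms(1) that, of "2 * B"] by (simp add: W_def power_mult_distrib mult_ac)
  have W0: "W > 0" by (simp add: W_def)
  let ?F = "\<lambda>x. ennreal (\<bar>g x\<bar> * exp (- (x\<^sup>2) / (2 * \<alpha>\<^sup>2)))"
  have gm[measurable]: "g \<in> borel_measurable borel"
    using g(1) by (rule borel_measurable_continuous_onI)
  have part: "(\<integral>\<^sup>+x\<in>S. ?F x \<partial>lborel) \<le> ennreal (W * M * exp (- B * real k) * exp (- B) ^ j)"
    if S: "S \<in> sets borel" "\<And>x. x \<in> S \<Longrightarrow> real j \<le> \<bar>x\<bar>"
      and le: "(\<integral>\<^sup>+x\<in>S. ennreal \<bar>g x\<bar> \<partial>lborel) \<le> 1"
        "j < k \<Longrightarrow> (\<integral>\<^sup>+x\<in>S. ennreal \<bar>g x\<bar> \<partial>lborel) \<le> ennreal (M * exp (- B * real (k - j)))"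
    for S j
  proof -
    \<comment> \<open>The real difference replaces the truncated \<open>k - j\<close>: for
      \<open>j >= k\<close> the exponential is at least 1, so the trivial bound 1 fits the same
      formula.\<close>
    have 1: "(\<integral>\<^sup>+x\<in>S. ennreal \<bar>g x\<bar> \<partial>lborel) \<le> ennreal (M * exp (- B * (real k - real j)))"
    proof (cases "j < k")
      case True
      then show ?thesis using le(2) by (simp add: of_nat_diff)
    next
      case False
      then have "0 \<le> - B * (real k - real j)" using \<open>B > 0\<close> by (simp add: mult_le_0_iff)
      then have "1 \<le> exp (- B * (real k - real j))" by (simp only: one_le_exp_iff)
      then have "1 * 1 \<le> M * exp (- B * (real k - real j))"
        using \<open>M \<ge> 1\<close> by (intro mult_mono) auto
      then show ?thesis using le(1) by (metis ennreal_1 ennreal_leI mult_1 order_trans)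
    qed
    have "(\<integral>\<^sup>+x\<in>S. ?F x \<partial>lborel)
        \<le> (\<integral>\<^sup>+x. ennreal (W * exp (- (2 * B * j))) * (ennreal \<bar>g x\<bar> * indicator S x) \<partial>lborel)"
    proof (intro nn_integral_mono)
      fix x
      show "?F x * indicator S x \<le> ennreal (W * exp (- (2 * B * j))) * (ennreal \<bar>g x\<bar> * indicator S x)"
      proof (cases "x \<in> S")
        case True
        have "\<bar>g x\<bar> * exp (- (x\<^sup>2) / (2 * \<alpha>\<^sup>2)) \<le> \<bar>g x\<bar> * (W * exp (- (2 * B * j)))"
          using W[of "real j" x] S(2)[OF True] by (intro mult_left_mono) auto
        then have "?F x \<le> ennreal (W * exp (- (2 * B * j)) * \<bar>g x\<bar>)"
          by (intro ennreal_leI) (simp add: mult.commute)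
        then show ?thesis using True W0 by (simp add: ennreal_mult)
      qed simp
    qed
    also have "\<dots> = ennreal (W * exp (- (2 * B * j))) * (\<integral>\<^sup>+x\<in>S. ennreal \<bar>g x\<bar> \<partial>lborel)"
      using S(1) by (intro nn_integral_cmult) simp
    also have "\<dots> \<le> ennreal (W * exp (- (2 * B * j))) * ennreal (M * exp (- B * (real k - real j)))"
      using 1 by (intro mult_left_mono) auto
    also have "\<dots> = ennreal (W * exp (- (2 * B * j)) * (M * exp (- B * (real k - real j))))"
      using W0 \<open>M \<ge> 1\<close> by (intro ennreal_mult[symmetric]) auto
    also have "W * exp (- (2 * B * j)) * (M * exp (- B * (real k - real j))) =
        W * M * exp (- B * real k) * exp (- B) ^ j"
      by (simp add: exp_of_nat_mult[symmetric] exp_add[symmetric] algebra_simps)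
    finally show ?thesis .
  qed
  \<comment> \<open>The factor 2 counts the two intervals with the same index
    \<open>j\<close>.\<close>
  define T where "T = (2 * W * M) * exp (- B * real k)"
  have q: "0 < exp (- B)" "exp (- B) < 1" using \<open>B > 0\<close> by auto
  have T: "T \<ge> 0" using W0 \<open>M \<ge> 1\<close> by (simp add: T_def)
  have "(\<integral>\<^sup>+x. ?F x \<partial>lborel) \<le> (\<Sum>j. (\<integral>\<^sup>+x\<in>{real j..real j + 1}. ?F x \<partial>lborel)
      + (\<integral>\<^sup>+x\<in>{- real j - 1..- real j}. ?F x \<partial>lborel))"
    by (rule nn_integral_le_suminf_unit_intervals) measurable
  also have "\<dots> \<le> (\<Sum>j. ennreal (T * exp (- B) ^ j))"
  proof (intro suminf_le allI)
    fix j
    have "(\<integral>\<^sup>+x\<in>{real j..real j + 1}. ?F x \<partial>lborel) + (\<integral>\<^sup>+x\<in>{- real j - 1..- real j}. ?F x \<partial>lborel)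
      \<le> ennreal (W * M * exp (- B * real k) * exp (- B) ^ j)
        + ennreal (W * M * exp (- B * real k) * exp (- B) ^ j)"
      using set_nn_integral_unit_le_1[of "\<lambda>x. \<bar>g x\<bar>" "real j"]
        set_nn_integral_unit_le_1[of "\<lambda>x. \<bar>g x\<bar>" "- real j - 1"] g(2) pos[of j] neg[of j]
      by (intro add_mono part) (auto simp: abs_if)
    also have "\<dots> = ennreal (T * exp (- B) ^ j)"
      using W0 \<open>M \<ge> 1\<close> by (simp add: T_def flip: ennreal_plus)
    finally show "(\<integral>\<^sup>+x\<in>{real j..real j + 1}. ?F x \<partial>lborel)
      + (\<integral>\<^sup>+x\<in>{- real j - 1..- real j}. ?F x \<partial>lborel) \<le> ennreal (T * exp (- B) ^ j)" .
  qed auto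
  also have "\<dots> = ennreal (T * (1 / (1 - exp (- B))))"
    using q T sums_mult[OF geometric_sums[of "exp (- B)"], of T]
    by (intro suminf_ennreal_eq) auto
  finally have F: "(\<integral>\<^sup>+x. ?F x \<partial>lborel) \<le> ennreal (T / (1 - exp (- B)))" by simp
  have "integrable lborel (\<lambda>x. g x * exp (- (x\<^sup>2) / (2 * \<alpha>\<^sup>2)))"
    using g(2) by (intro Bochner_Integration.integrable_bound[OF integrable_gauss_weight[OF \<open>\<alpha> > 0\<close>]])
      (auto simp: abs_mult mult_left_le_one_le)
  then have "ennreal \<bar>LINT x|lborel. g x * exp (- (x\<^sup>2) / (2 * \<alpha>\<^sup>2))\<bar> \<le> ennreal (T / (1 - exp (- B)))"
    using integral_norm_bound_ennreal F by (fastforce simp: abs_mult)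
  then have int: "\<bar>LINT x|lborel. g x * exp (- (x\<^sup>2) / (2 * \<alpha>\<^sup>2))\<bar> \<le> T / (1 - exp (- B))"
    using T q by simp
  have "\<bar>gauss_integral \<alpha> g\<bar> \<le> 1 / (sqrt (2 * pi) * \<alpha>) * (T / (1 - exp (- B)))"
    unfolding gauss_integral_def abs_mult using int \<open>\<alpha> > 0\<close>
    by (intro mult_mono) auto
  then show ?thesis
    by (intro ennreal_leI) (simp add: T_def W_def)
qed

section \<open>The error of the optimal rule\<close>

text \<open>The blocks contribute at most \<open>k * (k + 1)\<close> points; the square is used
  because its root is \<open>k + 1\<close>.\<close>

lemma card_nodes_le:
  assumes "\<And>m. m \<ge> 1 \<Longrightarrow> finite (Y m) \<and> card (Y m) = m"
  shows "finite (nodes Y k)" "card (nodes Y k) \<le> (k + 1)\<^sup>2"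
proof -
  have S: "shift_pos Y p q = (\<lambda>x. x + real q - 1) ` Y p" "shift_neg Y p q = (\<lambda>x. x - real q) ` Y p"
    for p q by (auto simp: shift_pos_def shift_neg_def)
  have fin: "finite (shift_pos Y (k - m + 1) m \<union> shift_neg Y (k - m + 1) m)" for m
    using assms by (simp add: S)
  then show "finite (nodes Y k)" unfolding nodes_def by blast
  have le: "card (shift_pos Y (k - m + 1) m \<union> shift_neg Y (k - m + 1) m) \<le> 2 * (k - m + 1)" for m
    using card_Un_le[of "shift_pos Y (k - m + 1) m" "shift_neg Y (k - m + 1) m"]
      card_image_le[of "Y (k - m + 1)" "\<lambda>x. x + real m - 1"]
      card_image_le[of "Y (k - m + 1)" "\<lambda>x. x - real m"] assms[of "k - m + 1"]
    by (simp add: S)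
  have "card (nodes Y k) \<le> (\<Sum>m\<in>{1..k}. 2 * (k - m + 1))"
    unfolding nodes_def using le by (intro order_trans[OF card_UN_le] sum_mono) auto
  also have "\<dots> = (\<Sum>m\<in>{1..k}. 2 * m)"
    by (rule sum.reindex_bij_witness[of _ "\<lambda>m. k - m + 1" "\<lambda>m. k - m + 1"]) auto
  also have "\<dots> = k * (k + 1)" by (induction k) auto
  also have "\<dots> \<le> (k + 1)\<^sup>2" by (simp add: power2_eq_square)
  finally show "card (nodes Y k) \<le> (k + 1)\<^sup>2" .
qed

text \<open>Block \<open>m = j + 1\<close> of the union carries \<open>k - m + 1 = k - j\<close>
  points on each side, inside \<open>[j, j + 1]\<close> and \<open>[- j - 1, - j]\<close>.\<close>

lemma shift_subset_nodes:
  assumes "j < k"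
  shows "(\<lambda>y. y + real j) ` Y (k - j) \<subseteq> nodes Y k"
    and "(\<lambda>y. y + (- real j - 1)) ` Y (k - j) \<subseteq> nodes Y k"
proof -
  have "j + 1 \<in> {1..k}" "k - (j + 1) + 1 = k - j" using assms by auto
  then have "shift_pos Y (k - j) (j + 1) \<union> shift_neg Y (k - j) (j + 1) \<subseteq> nodes Y k"
    unfolding nodes_def by (metis (no_types, lifting) UN_upper)
  moreover have "(\<lambda>y. y + real j) ` Y (k - j) = shift_pos Y (k - j) (j + 1)"
    "(\<lambda>y. y + (- real j - 1)) ` Y (k - j) = shift_neg Y (k - j) (j + 1)"
    by (auto simp: shift_pos_def shift_neg_def algebra_simps)
  ultimately show "(\<lambda>y. y + real j) ` Y (k - j) \<subseteq> nodes Y k"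
    "(\<lambda>y. y + (- real j - 1)) ` Y (k - j) \<subseteq> nodes Y k" by auto
qed

theorem theorem3p3:
  fixes \<alpha> l c_qu A h\<^sub>0 :: real
    and H :: "(real \<Rightarrow> real) set"
    and ip :: "(real \<Rightarrow> real) \<Rightarrow> (real \<Rightarrow> real) \<Rightarrow> real"
  assumes "\<alpha> > 0" and "l > 0" and "c_qu > 0"
    and "rkhs (gauss_kernel l) H ip"
    and "A > 0" and "0 < h\<^sub>0" and "h\<^sub>0 \<le> 1"
    and "power_function_bound H ip A h\<^sub>0"
  shows "\<exists>C>0. \<forall>Y :: nat \<Rightarrow> real set.
    (\<forall>m\<ge>1. Y m \<subseteq> {0<..<1} \<and> finite (Y m) \<and> card (Y m) = m \<and>
       fill_distance (Y m) {0<..<1} \<le> ennreal (c_qu / real m)) \<longrightarrow>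
    (\<forall>k :: nat. real k \<ge> 2 * c_qu * inverse (min h\<^sub>0 (inverse c_qu)) \<longrightarrow>
       worst_case_error H ip \<alpha> (opt_quadrature H ip \<alpha> (nodes Y k))
         \<le> ennreal (C * exp (- (sqrt (real (card (nodes Y k))) / (2 * sqrt 2 * \<alpha>\<^sup>2)))))"
proof -
  interpret rkhs "gauss_kernel l" H ip by fact
  \<comment> \<open>The rate of the claim, admissible because the decay lemmas hold for any
    rate.\<close>
  define B where "B = 1 / (2 * sqrt 2 * \<alpha>\<^sup>2)"
  have B: "B > 0" using \<open>\<alpha> > 0\<close> by (simp add: B_def)
  obtain M where M: "M \<ge> 1"
    and decay: "\<And>a X p f. finite X \<Longrightarrow> p > 0 \<Longrightarrow>
       fill_distance X {a..a + 1} \<le> ennreal (c_qu / p) \<Longrightarrow> f \<in> H \<Longrightarrow> fun_norm ip f \<le> 1 \<Longrightarrow>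
       (\<integral>\<^sup>+x\<in>{a..a + 1}. ennreal \<bar>f x - interpolant H ip X f x\<bar> \<partial>lborel) \<le> ennreal (M * exp (- B * p))"
    using interpolation_error_decay[OF assms(4,8,5,6,3) less_imp_le[OF B]] by blast
  \<comment> \<open>Fixed before \<open>Y\<close> and \<open>k\<close>, as the constant of the claim
    has to be.\<close>
  define D where "D = 1 / (sqrt (2 * pi) * \<alpha>) * (2 * exp (2 * \<alpha>\<^sup>2 * B\<^sup>2) * M / (1 - exp (- B)))"
  have D: "D > 0" unfolding D_def using \<open>\<alpha> > 0\<close> M B by (intro mult_pos_pos divide_pos_pos) auto
  have "worst_case_error H ip \<alpha> (opt_quadrature H ip \<alpha> (nodes Y k))
      \<le> ennreal (D * exp B * exp (- (sqrt (real (card (nodes Y k))) / (2 * sqrt 2 * \<alpha>\<^sup>2))))"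
    if Y: "\<forall>m\<ge>1. Y m \<subseteq> {0<..<1} \<and> finite (Y m) \<and> card (Y m) = m \<and>
       fill_distance (Y m) {0<..<1} \<le> ennreal (c_qu / real m)" for Y k
  proof -
    let ?X = "nodes Y k"
    have X: "finite ?X" and card: "card ?X \<le> (k + 1)\<^sup>2"
      using card_nodes_le[of Y k] Y by blast+
    have fill: "fill_distance ?X {a..a + 1} \<le> ennreal (c_qu / real (k - j))"
      if "j < k" "(\<lambda>y. y + a) ` Y (k - j) \<subseteq> ?X" for a j
    proof -
      have "k - j \<ge> 1" using that by simp
      then show ?thesis
        using fill_distance_translate_le[OF X _ _ that(2), of "c_qu / real (k - j)"]
          Y[rule_format, of "k - j"] \<open>c_qu > 0\<close> by simp
    qed
    have "ennreal \<bar>gauss_integral \<alpha> (\<lambda>x. f x - interpolant H ip ?X f x)\<bar>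
        \<le> ennreal (D * exp (- B * real k))" if f: "f \<in> H" "fun_norm ip f \<le> 1" for f
      unfolding D_def
    proof (rule gauss_integral_le[OF \<open>\<alpha> > 0\<close> B M])
      have d: "(\<lambda>x. f x - interpolant H ip ?X f x) \<in> H"
        by (intro diff_mem interpolant_mem f X)
      then show "continuous_on UNIV (\<lambda>x. f x - interpolant H ip ?X f x)"
        by (rule rkhs_gauss_continuous[OF assms(4)])
      show "\<bar>f x - interpolant H ip ?X f x\<bar> \<le> 1" for x
        using rkhs_gauss_abs_le[OF assms(4) d, of x] fun_norm_diff_interpolant_le[OF X f(1)] f(2)
        by simp
      fix j
      assume j: "j < k"
      show "(\<integral>\<^sup>+x\<in>{real j..real j + 1}. ennreal \<bar>f x - interpolant H ip ?X f x\<bar> \<partial>lborel)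
          \<le> ennreal (M * exp (- B * real (k - j)))"
        using j f by (intro decay[OF X] fill shift_subset_nodes) auto
      show "(\<integral>\<^sup>+x\<in>{- real j - 1..- real j}. ennreal \<bar>f x - interpolant H ip ?X f x\<bar> \<partial>lborel)
          \<le> ennreal (M * exp (- B * real (k - j)))"
        using decay[OF X _ fill[OF j shift_subset_nodes(2)[OF j]] f] j by simp
    qed
    then have "worst_case_error H ip \<alpha> (opt_quadrature H ip \<alpha> ?X) \<le> ennreal (D * exp (- B * real k))"
      by (rule worst_case_error_opt_le[OF assms(4) \<open>\<alpha> > 0\<close> X])
    also have "\<dots> \<le> ennreal (D * exp B * exp (- (sqrt (real (card ?X)) / (2 * sqrt 2 * \<alpha>\<^sup>2))))"
    proof -
      \<comment> \<open>Replacing \<open>k\<close> by the root of the number of nodes loses at most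
        1 in the exponent before multiplication by \<open>B\<close>, hence the factor
        \<open>exp B\<close>.\<close>
      have "real (card ?X) \<le> (real k + 1)\<^sup>2"
        using card by (metis Suc_eq_plus1 of_nat_Suc of_nat_le_iff of_nat_power add.commute)
      then have "B * sqrt (real (card ?X)) \<le> B * (real k + 1)"
        using B by (intro mult_left_mono) (auto intro: real_le_lsqrt)
      then have "exp (- B * real k) \<le> exp (B + - (B * sqrt (real (card ?X))))"
        by (simp add: algebra_simps)
      then have "D * exp (- B * real k) \<le> D * (exp B * exp (- (B * sqrt (real (card ?X)))))"
        using D unfolding exp_add by (intro mult_left_mono) auto
      then show ?thesis
        by (intro ennreal_leI) (simp add: B_def mult.assoc)
    qed
    finally show ?thesis .
  qed
  then show ?thesis using D by (intro exI[of _ "D * exp B"]) simp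
qed

end
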